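(* Let $\mathcal{C}$ be the set of finite discrete symbolic states, i.e. the symbolic states $g$ such that every distribution $g(X)$ is a Bernoulli distribution $\mathrm{Bernoulli}(p)$ (with $p$ a symbolic expression). Then $\mathcal{C}$ is a closed family.
   Context: **Expressions and states.** Fix a set $\mathcal{V}$ of random variable names. Symbolic expressions are $E ::= \mathtt{app}(op,E,\dots,E)\mid r\mid c\mid X$ with $r\in\mathbb{R}$, $c\in\mathbb{Z}$, $X\in\mathcal{V}$ and $op$ one of $+,-,*,/,\mathtt{sqrt},\mathtt{ite},=,\neq,<,\le$. Symbolic distributions are $\mathcal{N}(E,E)$ (mean, variance), $\mathrm{Bernoulli}(E)$, $\beta(E,E)$, $\delta(E)$. We write $e_1+e_2$, $e_1-e_2$, $e_1*e_2$, $\frac{e_1}{e_2}$, $\mathtt{ite}(e_1,e_2,e_3)$ for the corresponding symbolic terms (term constructors; no arithmetic is performed), and $e_1[X\leftarrow e_2]$ for substitution. A symbolic state $g$ is a finite map from $\mathcal{V}$ to symbolic distributions; $Y$ is a parent of $X$ in $g$ if $Y$ occurs in $g(X)$; $\mathrm{pa}(X)$ is the set of parents. All symbolic states are acyclic for the parent relation and every parent lies in the domain of $g$. $g[X\mapsto d]$ denotes update. **Swap.** $\mathrm{SWAP}(X_1,X_2,g)$, applied when $X_1$ is a parent of $X_2$, returns a pair (state, Boolean): 1. If $g(X_1)=\mathcal{N}(\mu_0,v_0)$, $g(X_2)=\mathcal{N}(\mu,v)$, $\mu$ can be analysed as $a*X_1+b$ with $a,b$ symbolic expressions not containing $X_1$,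 and $v_0,v$ contain no random variables: put $\mu_0'=(a*\mu_0)+b$, $v_0'=(a*a)*v_0$, $v_0''=\frac{1}{\frac1{v_0'}+\frac1v}$, $\mu_0''=\left(\frac{\mu_0'}{v_0'}+\frac{X_2}{v}\right)*v_0''$, and return $\left(g\left[X_1\mapsto\mathcal{N}\left(\frac{\mu_0''-b}{a},\frac{v_0''}{a*a}\right)\right]\left[X_2\mapsto\mathcal{N}(\mu_0',v_0'+v)\right],\mathbf{true}\right)$. 2. If $g(X_1)=\beta(a,b)$, $g(X_2)=\mathrm{Bernoulli}(X_1)$: return $\left(g\left[X_1\mapsto\beta(a+\mathtt{ite}(X_2,1,0),\,b+\mathtt{ite}(X_2,0,1))\right]\left[X_2\mapsto\mathrm{Bernoulli}\left(\frac{a}{a+b}\right)\right],\mathbf{true}\right)$. 3. If $g(X_1)=\mathrm{Bernoulli}(p_1)$, $g(X_2)=\mathrm{Bernoulli}(p_2)$: put $p_2'=(p_1*p_2[X_1\leftarrow1])+((1-p_1)*p_2[X_1\leftarrow0])$ and $p_1'=\frac{p_1*\left(\mathtt{ite}(X_2,p_2,1-p_2)[X_1\leftarrow1]\right)}{\mathtt{ite}(X_2,p_2',1-p_2')}$, and return $(g[X_1\mapsto\mathrm{Bernoulli}(p_1')][X_2\mapsto\mathrm{Bernoulli}(p_2')],\mathbf{true})$. 4. Otherwise return $(g,\mathbf{false})$. **Legal swaps.** $\mathrm{CAN\_SWAP}(X_1,X_2,g)$ is true iff swapping creates no dependency cycle, i.e. iff the graph obtained from the parent graph of $g$ by giving $X_2$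 the parents $(\mathrm{pa}(X_1)\cup\mathrm{pa}(X_2))\setminus\{X_1\}$ and $X_1$ the parents $(\mathrm{pa}(X_1)\cup\mathrm{pa}(X_2)\cup\{X_2\})\setminus\{X_1\}$ (other variables unchanged) is acyclic. **Closed family.** A closed family is a set $\mathcal{C}$ of symbolic states such that whenever $g\in\mathcal{C}$ and $X_1,X_2$ in the domain of $g$, with $X_1$ a parent of $X_2$, satisfy $\mathrm{CAN\_SWAP}(X_1,X_2,g)$, then $\mathrm{SWAP}(X_1,X_2,g)=(g',\mathbf{true})$ with $g'\in\mathcal{C}$. *)

theory Defs
  imports Complex_Main "HOL-Library.Finite_Map"
begin

datatype op_name = Plus | Minus | Times | Divide | Sqrt | Ite | Equal | NotEqual | Less | LessEq

text \<open>The type variable \<^typ>\<open>'v\<close> is the set of random variable names.\<close>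

datatype (rvars: 'v) sexpr =
    App op_name "'v sexpr list"
  | RConst real
  | IConst int
  | RVar 'v

datatype (dist_rvars: 'v) sdist =
    Normal "'v sexpr" "'v sexpr"  \<comment> \<open>mean and variance\<close>
  | Bernoulli "'v sexpr"
  | Beta "'v sexpr" "'v sexpr"
  | Delta "'v sexpr"

abbreviation plus_e :: "'v sexpr \<Rightarrow> 'v sexpr \<Rightarrow> 'v sexpr"  (infixl "+\<^sub>e" 65)
  where "e1 +\<^sub>e e2 \<equiv> App Plus [e1, e2]"

abbreviation minus_e :: "'v sexpr \<Rightarrow> 'v sexpr \<Rightarrow> 'v sexpr"  (infixl "-\<^sub>e" 65)
  where "e1 -\<^sub>e e2 \<equiv> App Minus [e1, e2]"

abbreviation times_e :: "'v sexpr \<Rightarrow> 'v sexpr \<Rightarrow> 'v sexpr"  (infixl "*\<^sub>e" 70)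
  where "e1 *\<^sub>e e2 \<equiv> App Times [e1, e2]"

abbreviation divide_e :: "'v sexpr \<Rightarrow> 'v sexpr \<Rightarrow> 'v sexpr"  (infixl "'/\<^sub>e" 70)
  where "e1 /\<^sub>e e2 \<equiv> App Divide [e1, e2]"

abbreviation ite_e :: "'v sexpr \<Rightarrow> 'v sexpr \<Rightarrow> 'v sexpr \<Rightarrow> 'v sexpr"
  where "ite_e e1 e2 e3 \<equiv> App Ite [e1, e2, e3]"

text \<open>The literals 0 and 1 in the swap formulas are integer constants.\<close>

abbreviation zero_e :: "'v sexpr"  ("0\<^sub>e")
  where "0\<^sub>e \<equiv> IConst 0"

abbreviation one_e :: "'v sexpr"  ("1\<^sub>e")
  where "1\<^sub>e \<equiv> IConst 1"

primrec subst :: "'v sexpr \<Rightarrow> 'v \<Rightarrow> 'v sexpr \<Rightarrow> 'v sexpr"  ("_[_ \<leftarrow>\<^sub>e _]" [1000, 0, 0] 1000)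
  where
    "(App f es)[X \<leftarrow>\<^sub>e e'] = App f (map (\<lambda>e. e[X \<leftarrow>\<^sub>e e']) es)"
  | "(RConst r)[X \<leftarrow>\<^sub>e e'] = RConst r"
  | "(IConst c)[X \<leftarrow>\<^sub>e e'] = IConst c"
  | "(RVar Y)[X \<leftarrow>\<^sub>e e'] = (if Y = X then e' else RVar Y)"

type_synonym 'v state = "('v, 'v sdist) fmap"

definition pa :: "'v state \<Rightarrow> 'v \<Rightarrow> 'v set"
  where "pa g X = (case fmlookup g X of None \<Rightarrow> {} | Some d \<Rightarrow> dist_rvars d)"

text \<open>A graph is given by its parent function; edges go from parent to child.\<close>

definition acyclic_parents :: "('v \<Rightarrow> 'v set) \<Rightarrow> bool"
  where "acyclic_parents P \<longleftrightarrow> acyclic {(Y, X). Y \<in> P X}"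

definition symbolic_state :: "'v state \<Rightarrow> bool"
  where "symbolic_state g \<longleftrightarrow> acyclic_parents (pa g) \<and> (\<forall>X. pa g X \<subseteq> fmdom' g)"

text \<open>
  An affine analysis attempts to write an expression \<open>\<mu>\<close> as \<open>a * X + b\<close>, returning
  \<open>Some (a, b)\<close> on success. The swap operation is parametric in the analysis employed;
  that \<open>X\<close> must not occur in \<open>a\<close> and \<open>b\<close> is tested by \<open>swap\<close> itself.
\<close>

type_synonym 'v affine_analysis = "'v sexpr \<Rightarrow> 'v \<Rightarrow> ('v sexpr \<times> 'v sexpr) option"

definition swap_normal ::
    "'v \<Rightarrow> 'v \<Rightarrow> 'v sexpr \<Rightarrow> 'v sexpr \<Rightarrow> 'v sexpr \<Rightarrow> 'v sexpr \<Rightarrow> 'v sexpr \<Rightarrow> 'v state \<Rightarrow> 'v state"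
  where "swap_normal X1 X2 mu0 v0 a b v g =
    (let mu0' = (a *\<^sub>e mu0) +\<^sub>e b;
         v0' = (a *\<^sub>e a) *\<^sub>e v0;
         v0'' = 1\<^sub>e /\<^sub>e ((1\<^sub>e /\<^sub>e v0') +\<^sub>e (1\<^sub>e /\<^sub>e v));
         mu0'' = ((mu0' /\<^sub>e v0') +\<^sub>e (RVar X2 /\<^sub>e v)) *\<^sub>e v0''
     in fmupd X2 (Normal mu0' (v0' +\<^sub>e v))
         (fmupd X1 (Normal ((mu0'' -\<^sub>e b) /\<^sub>e a) (v0'' /\<^sub>e (a *\<^sub>e a))) g))"

definition swap_beta_bernoulli ::
    "'v \<Rightarrow> 'v \<Rightarrow> 'v sexpr \<Rightarrow> 'v sexpr \<Rightarrow> 'v state \<Rightarrow> 'v state"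
  where "swap_beta_bernoulli X1 X2 a b g =
    fmupd X2 (Bernoulli (a /\<^sub>e (a +\<^sub>e b)))
      (fmupd X1 (Beta (a +\<^sub>e ite_e (RVar X2) 1\<^sub>e 0\<^sub>e) (b +\<^sub>e ite_e (RVar X2) 0\<^sub>e 1\<^sub>e)) g)"

definition swap_bernoulli ::
    "'v \<Rightarrow> 'v \<Rightarrow> 'v sexpr \<Rightarrow> 'v sexpr \<Rightarrow> 'v state \<Rightarrow> 'v state"
  where "swap_bernoulli X1 X2 p1 p2 g =
    (let p2' = (p1 *\<^sub>e p2[X1 \<leftarrow>\<^sub>e 1\<^sub>e]) +\<^sub>e ((1\<^sub>e -\<^sub>e p1) *\<^sub>e p2[X1 \<leftarrow>\<^sub>e 0\<^sub>e]);
         p1' = (p1 *\<^sub>e (ite_e (RVar X2) p2 (1\<^sub>e -\<^sub>e p2))[X1 \<leftarrow>\<^sub>e 1\<^sub>e])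
                 /\<^sub>e ite_e (RVar X2) p2' (1\<^sub>e -\<^sub>e p2')
     in fmupd X2 (Bernoulli p2') (fmupd X1 (Bernoulli p1') g))"

definition swap :: "'v affine_analysis \<Rightarrow> 'v \<Rightarrow> 'v \<Rightarrow> 'v state \<Rightarrow> 'v state \<times> bool"
  where "swap aff X1 X2 g =
    (case (fmlookup g X1, fmlookup g X2) of
       (Some (Normal mu0 v0), Some (Normal mu v)) \<Rightarrow>
         (case aff mu X1 of
            Some (a, b) \<Rightarrow>
              if X1 \<notin> rvars a \<and> X1 \<notin> rvars b \<and> rvars v0 = {} \<and> rvars v = {}
              then (swap_normal X1 X2 mu0 v0 a b v g, True)
              else (g, False)
          | None \<Rightarrow> (g, False))
     | (Some (Beta a b), Some (Bernoulli p)) \<Rightarrow>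
         if p = RVar X1 then (swap_beta_bernoulli X1 X2 a b g, True) else (g, False)
     | (Some (Bernoulli p1), Some (Bernoulli p2)) \<Rightarrow> (swap_bernoulli X1 X2 p1 p2 g, True)
     | _ \<Rightarrow> (g, False))"

definition can_swap :: "'v \<Rightarrow> 'v \<Rightarrow> 'v state \<Rightarrow> bool"
  where "can_swap X1 X2 g \<longleftrightarrow>
    acyclic_parents ((pa g)
      (X2 := (pa g X1 \<union> pa g X2) - {X1},
       X1 := (pa g X1 \<union> pa g X2 \<union> {X2}) - {X1}))"

definition closed_family :: "'v affine_analysis \<Rightarrow> 'v state set \<Rightarrow> bool"
  where "closed_family aff C \<longleftrightarrow>
    (\<forall>g\<in>C. symbolic_state g) \<and>
    (\<forall>g\<in>C. \<forall>X1\<in>fmdom' g. \<forall>X2\<in>fmdom' g.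
       X1 \<in> pa g X2 \<and> can_swap X1 X2 g \<longrightarrow>
       (\<exists>g'\<in>C. swap aff X1 X2 g = (g', True)))"

definition finite_discrete_states :: "'v state set"
  where "finite_discrete_states =
    {g. symbolic_state g \<and> (\<forall>X\<in>fmdom' g. \<exists>p. fmlookup g X = Some (Bernoulli p))}"

end

theory Submission
  imports Defs
begin

text \<open>Two Bernoulli nodes always reach the third case of \<open>swap\<close>, which succeeds
  and writes Bernoulli nodes again. What remains is that the new state is a symbolic state. By
  \<open>pa_swap_bernoulli_subset\<close>, its parent graph is contained in the graph that
  \<open>can_swap\<close> declares acyclic, and a subgraph of an acyclic graph is acyclic. That
  larger graph also has all its parents in the old domain, which the swap preserves.\<close>

lemma rvars_subst_subset: "rvars e[X \<leftarrow>\<^sub>e e'] \<subseteq> (rvars e - {X}) \<union> rvars e'"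
  by (induction e) auto

lemma acyclic_parents_mono:
  assumes "acyclic_parents Q" and "\<And>X. P X \<subseteq> Q X"
  shows "acyclic_parents P"
  using assms unfolding acyclic_parents_def by (blast intro: acyclic_subset)

lemma acyclic_parents_irrefl:
  assumes "acyclic_parents P"
  shows "X \<notin> P X"
  using assms unfolding acyclic_parents_def acyclic_def by blast

lemma pa_fmupd: "pa (fmupd X d g) = (pa g)(X := dist_rvars d)"
  by (auto simp: pa_def fun_eq_iff)

text \<open>The right-hand side is the graph tested by \<open>can_swap\<close>. Replacing
  \<open>X1\<close> by a constant in \<open>p2\<close> deletes \<open>X1\<close> and adds no
  variable, and \<open>p1\<close> does not mention \<open>X1\<close>. The extra parent
  \<open>X2\<close> of \<open>X1\<close> comes from the \<open>RVar X2\<close> in the new parameter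
  of \<open>X1\<close>, which survives the substitution because \<open>X1\<close> and
  \<open>X2\<close> differ.\<close>

lemma pa_swap_bernoulli_subset:
  assumes "X1 \<noteq> X2" and "X1 \<notin> rvars p1"
  shows "pa (swap_bernoulli X1 X2 p1 p2 g) X \<subseteq>
    ((pa g)(X2 := (rvars p1 \<union> rvars p2) - {X1},
            X1 := (rvars p1 \<union> rvars p2 \<union> {X2}) - {X1})) X"
proof -
  have "rvars p2[X1 \<leftarrow>\<^sub>e IConst c] \<subseteq> rvars p2 - {X1}" for c
    using rvars_subst_subset[of p2 X1 "IConst c"] by simp
  then show ?thesis
    using assms by (auto simp: swap_bernoulli_def Let_def pa_fmupd)
qed

theorem theorem5p3:
  fixes aff :: "'v affine_analysis"
  shows "closed_family aff (finite_discrete_states :: 'v state set)"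
  unfolding closed_family_def
proof (intro conjI ballI impI)
  fix g :: "'v state"
  assume "g \<in> finite_discrete_states"
  then show "symbolic_state g"
    by (simp add: finite_discrete_states_def)
next
  fix g :: "'v state" and X1 X2
  assume g: "g \<in> finite_discrete_states"
    and dom: "X1 \<in> fmdom' g" "X2 \<in> fmdom' g"
    and swappable: "X1 \<in> pa g X2 \<and> can_swap X1 X2 g"
  obtain p1 p2 where p: "fmlookup g X1 = Some (Bernoulli p1)" "fmlookup g X2 = Some (Bernoulli p2)"
    using g dom unfolding finite_discrete_states_def by blast
  have acyc: "acyclic_parents (pa g)" and closed: "\<And>X. pa g X \<subseteq> fmdom' g"
    using g by (auto simp: finite_discrete_states_def symbolic_state_def)
  have pa: "pa g X1 = rvars p1" "pa g X2 = rvars p2"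
    using p by (simp_all add: pa_def)
  \<comment> \<open>Either failure would be a self-loop in the acyclic parent graph of
    \<open>g\<close>.\<close>
  have neq: "X1 \<noteq> X2" and X1: "X1 \<notin> rvars p1"
    using acyclic_parents_irrefl[OF acyc] swappable pa by metis+
  define g' where "g' = swap_bernoulli X1 X2 p1 p2 g"
  define Q where "Q = (pa g)(X2 := (rvars p1 \<union> rvars p2) - {X1},
                             X1 := (rvars p1 \<union> rvars p2 \<union> {X2}) - {X1})"
  have sub: "pa g' X \<subseteq> Q X" for X
    unfolding g'_def Q_def by (rule pa_swap_bernoulli_subset[OF neq X1])
  have "acyclic_parents Q"
    using swappable by (simp add: can_swap_def Q_def pa)
  then have "acyclic_parents (pa g')"
    using sub by (rule acyclic_parents_mono)
  moreover have dom': "fmdom' g' = fmdom' g"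
    using dom by (auto simp: g'_def swap_bernoulli_def Let_def)
  \<comment> \<open>Each edge of \<open>Q\<close> starts at a parent already present in
    \<open>g\<close> or at \<open>X2\<close>.\<close>
  moreover have "Q X \<subseteq> fmdom' g" for X
    using closed[of X] closed[of X1] closed[of X2] dom by (auto simp: Q_def pa)
  ultimately have "symbolic_state g'"
    using sub unfolding symbolic_state_def by (metis order_trans)
  moreover have "\<exists>p. fmlookup g' X = Some (Bernoulli p)" if "X \<in> fmdom' g'" for X
    using g that unfolding dom' by (auto simp: finite_discrete_states_def g'_def swap_bernoulli_def Let_def)
  ultimately have "g' \<in> finite_discrete_states"
    by (simp add: finite_discrete_states_def)
  moreover have "swap aff X1 X2 g = (g', True)"
    by (simp add: swap_def p g'_def)
  ultimately show "\<exists>g'\<in>finite_discrete_states. swap aff X1 X2 g = (g', True)"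
    by blast
qed

end
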